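(* Let $n\ge1$, $\mathbf{m}=(m_1,\dots,m_n)$ a vector of positive integers, $m=m_1+\cdots+m_n$, $r\ge1$ an integer and $\mathbf{r}=(r,\dots,r)\in\mathbb{Z}^n$. Then, as formal power series in $z_0,z_1,\dots,z_n$, $$\sum_{\pi^{\mathbf{c}}\in\mathfrak{S}_{\mathbf{m}}^{\mathbf{r}}}\frac{\prod_{i=1}^{m}(z_0z_{\pi_1}\cdots z_{\pi_i})^{a_i(\pi^{\mathbf{c}})}\ \prod_{\substack{i\in\mathrm{DES}(\pi^{\mathbf{c}})\\ a_i(\pi^{\mathbf{c}})=0}}(z_0z_{\pi_1}\cdots z_{\pi_i})^{r}}{(1-z_0)\prod_{i=1}^{m}\bigl(1-(z_0z_{\pi_1}\cdots z_{\pi_i})^{r}\bigr)}=\sum_{t\ge0}z_0^t\prod_{k=1}^n\begin{bmatrix}t+m_k\\ m_k\end{bmatrix}_{z_k}.$$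
   Context: $\mathfrak{S}_{\mathbf{m}}^{\mathbf{r}}$ (here with $\mathbf{r}=(r,\dots,r)$) denotes the set of colored multiset permutations: words $\pi^{\mathbf{c}}=\pi_1^{c_1}\pi_2^{c_2}\cdots\pi_m^{c_m}$ in which each $k\in\{1,\dots,n\}$ appears exactly $m_k$ times among $\pi_1,\dots,\pi_m$, and each color $c_j$ is an integer with $1\le c_j\le r$. One always appends $\pi_{m+1}^{c_{m+1}}:=(n+1)^1$, so $c_{m+1}=1$. Colored letters are totally ordered by the color ordering: $k^{c}<l^{c'}$ iff $c<c'$, or $c=c'$ and $k<l$. An index $j\in\{1,\dots,m\}$ is a descent of $\pi^{\mathbf{c}}$ if $\pi_j^{c_j}>\pi_{j+1}^{c_{j+1}}$; $\mathrm{DES}(\pi^{\mathbf{c}})$ is the set of descents. For $j\in\{1,\dots,m\}$, the $j$-th color change $a_j(\pi^{\mathbf{c}})\in\{0,1,\dots,r-1\}$ is the residue of $c_j-c_{j+1}$ modulo $r$. $\begin{bmatrix}N\\ M\end{bmatrix}_q$ is the Gaussian ($q$-)binomial coefficient $\prod_{i=1}^{M}\frac{1-q^{N-M+i}}{1-q^i}$. *)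

theory Defs
  imports Complex_Main "HOL-Library.Poly_Mapping"
begin

section \<open>Formal power series in a set of commuting variables\<close>

text \<open>
  Monomials in variables indexed by \<^typ>\<open>'v\<close> are finitely supported exponent vectors
  \<^typ>\<open>'v \<Rightarrow>\<^sub>0 nat\<close>; a power series is an arbitrary function from monomials to coefficients.
\<close>

typedef ('v, 'a) mfps = "UNIV :: (('v \<Rightarrow>\<^sub>0 nat) \<Rightarrow> 'a) set"
  morphisms mfps_coeff Abs_mfps
  by simp

setup_lifting type_definition_mfps

lemma mfps_eqI: "(\<And>x. mfps_coeff f x = mfps_coeff g x) \<Longrightarrow> f = g"
  by (metis ext mfps_coeff_inject)

lemma mfps_coeff_Abs [simp]: "mfps_coeff (Abs_mfps h) = h"
  by (simp add: Abs_mfps_inverse)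

lemma finite_monom_le: "finite {a :: 'v \<Rightarrow>\<^sub>0 nat. \<exists>b. a + b = x}"
proof (rule finite_imageD)
  let ?F = "{h :: 'v \<Rightarrow> nat. \<forall>i. (i \<in> Poly_Mapping.keys x \<longrightarrow> h i \<in> {..Max (range (Poly_Mapping.lookup x))})
                     \<and> (i \<notin> Poly_Mapping.keys x \<longrightarrow> h i = 0)}"
  have "finite (Poly_Mapping.lookup x ` Poly_Mapping.keys x \<union> {0})"
    by simp
  moreover have "range (Poly_Mapping.lookup x) \<subseteq> Poly_Mapping.lookup x ` Poly_Mapping.keys x \<union> {0}"
    by (auto simp: in_keys_iff)
  ultimately have fin: "finite (range (Poly_Mapping.lookup x))"
    by (rule rev_finite_subset)
  have "Poly_Mapping.lookup ` {a. \<exists>b. a + b = x} \<subseteq> ?F"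
  proof clarify
    fix a b :: "'v \<Rightarrow>\<^sub>0 nat" and i
    assume x: "x = a + b"
    have "Poly_Mapping.lookup a i \<le> Poly_Mapping.lookup x i"
      by (simp add: x lookup_add)
    also have "\<dots> \<le> Max (range (Poly_Mapping.lookup x))"
      using fin by simp
    finally show "(i \<in> Poly_Mapping.keys (a + b) \<longrightarrow>
           Poly_Mapping.lookup a i \<in> {..Max (range (Poly_Mapping.lookup (a + b)))}) \<and>
          (i \<notin> Poly_Mapping.keys (a + b) \<longrightarrow> Poly_Mapping.lookup a i = 0)"
      by (auto simp: x in_keys_iff lookup_add)
  qed
  moreover have "finite ?F"
    by (rule finite_set_of_finite_funs) simp_all
  ultimately show "finite (Poly_Mapping.lookup ` {a. \<exists>b. a + b = x})"
    by (rule finite_subset)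
qed (simp add: inj_on_def)

lemma finite_monom_splits [simp]:
  fixes x :: "'v \<Rightarrow>\<^sub>0 nat"
  shows "finite {(a, b). a + b = x}"
proof -
  have "{(a, b). a + b = x} \<subseteq> {a. \<exists>b. a + b = x} \<times> {b. \<exists>a. b + a = x}"
    by (auto intro: exI [where P = "\<lambda>a. _ + a = _", OF add.commute])
  moreover have "finite ({a. \<exists>b. a + b = x} \<times> {b. \<exists>a. b + a = x})"
    by (intro finite_cartesian_product finite_monom_le)
  ultimately show ?thesis
    by (rule finite_subset)
qed

instantiation mfps :: (type, comm_ring_1) comm_ring_1
begin

lift_definition zero_mfps :: "('a, 'b) mfps" is "\<lambda>_. 0" .

lift_definition one_mfps :: "('a, 'b) mfps" is "\<lambda>x. if x = 0 then 1 else 0" .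

lift_definition plus_mfps :: "('a, 'b) mfps \<Rightarrow> ('a, 'b) mfps \<Rightarrow> ('a, 'b) mfps"
  is "\<lambda>f g x. f x + g x" .

lift_definition minus_mfps :: "('a, 'b) mfps \<Rightarrow> ('a, 'b) mfps \<Rightarrow> ('a, 'b) mfps"
  is "\<lambda>f g x. f x - g x" .

lift_definition uminus_mfps :: "('a, 'b) mfps \<Rightarrow> ('a, 'b) mfps"
  is "\<lambda>f x. - f x" .

lift_definition times_mfps :: "('a, 'b) mfps \<Rightarrow> ('a, 'b) mfps \<Rightarrow> ('a, 'b) mfps"
  is "\<lambda>f g x. \<Sum>(a, b)\<in>{(a, b). a + b = x}. f a * g b" .

instance
proof
  fix f g h :: "('a, 'b) mfps"
  show "f * g * h = f * (g * h)"
  proof (rule mfps_eqI)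
    fix x
    let ?f = "mfps_coeff f" and ?g = "mfps_coeff g" and ?h = "mfps_coeff h"
    have "mfps_coeff (f * g * h) x =
      (\<Sum>(p, c)\<in>{(p, c). p + c = x}. \<Sum>(a, b)\<in>{(a, b). a + b = p}. ?f a * ?g b * ?h c)"
      by (simp add: times_mfps.rep_eq sum_distrib_right case_prod_unfold)
    also have "\<dots> = (\<Sum>((p, c), (a, b)) \<in> (SIGMA pc:{(p, c). p + c = x}. {(a, b). a + b = fst pc}).
        ?f a * ?g b * ?h c)"
      by (subst sum.Sigma [symmetric]) (simp_all add: split_def finite_monom_splits [unfolded split_def])
    also have "\<dots> = (\<Sum>((a, q), (b, c)) \<in> (SIGMA aq:{(a, q). a + q = x}. {(b, c). b + c = snd aq}).
        ?f a * (?g b * ?h c))"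
      by (rule sum.reindex_bij_witness
          [of _ "\<lambda>((a, q), (b, c)). ((a + b, c), (a, b))" "\<lambda>((p, c), (a, b)). ((a, b + c), (b, c))"])
        (auto simp: ac_simps)
    also have "\<dots> = (\<Sum>(a, q)\<in>{(a, q). a + q = x}. \<Sum>(b, c)\<in>{(b, c). b + c = q}. ?f a * (?g b * ?h c))"
      by (subst sum.Sigma [symmetric]) (simp_all add: split_def finite_monom_splits [unfolded split_def])
    also have "\<dots> = mfps_coeff (f * (g * h)) x"
      by (simp add: times_mfps.rep_eq sum_distrib_left case_prod_unfold)
    finally show "mfps_coeff (f * g * h) x = mfps_coeff (f * (g * h)) x" .
  qed
  show "f * g = g * f"
  proof (rule mfps_eqI)
    fix x
    show "mfps_coeff (f * g) x = mfps_coeff (g * f) x"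
      unfolding times_mfps.rep_eq
      by (rule sum.reindex_bij_witness [of _ "\<lambda>(a, b). (b, a)" "\<lambda>(a, b). (b, a)"])
        (auto simp: ac_simps)
  qed
  show "1 * f = f"
  proof (rule mfps_eqI)
    fix x
    have "mfps_coeff (1 * f) x = (\<Sum>(a, b) \<in> {(0, x)}. mfps_coeff 1 a * mfps_coeff f b)"
      unfolding times_mfps.rep_eq
      by (rule sum.mono_neutral_right [OF finite_monom_splits]) (auto simp: one_mfps.rep_eq split: if_splits)
    then show "mfps_coeff (1 * f) x = mfps_coeff f x"
      by (simp add: one_mfps.rep_eq)
  qed
  show "(f + g) * h = f * h + g * h"
    by (rule mfps_eqI)
      (simp add: times_mfps.rep_eq plus_mfps.rep_eq distrib_right sum.distrib case_prod_unfold)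
  show "(0 :: ('a, 'b) mfps) \<noteq> 1"
  proof
    assume "(0 :: ('a, 'b) mfps) = 1"
    then have "mfps_coeff (0 :: ('a, 'b) mfps) 0 = mfps_coeff 1 0"
      by simp
    then show False
      by (simp add: zero_mfps.rep_eq one_mfps.rep_eq)
  qed
qed (rule mfps_eqI; simp add: plus_mfps.rep_eq minus_mfps.rep_eq uminus_mfps.rep_eq zero_mfps.rep_eq)+

end

definition mfps_var :: "'v \<Rightarrow> ('v, 'a :: comm_ring_1) mfps" where
  "mfps_var v = Abs_mfps (\<lambda>x. if x = Poly_Mapping.single v 1 then 1 else 0)"

text \<open>
  The inverse of a unit is its unique multiplicative inverse, and the inverse of a non-unit
  is set to 0.
\<close>

instantiation mfps :: (type, comm_ring_1) inverse
begin

definition inverse_mfps :: "('a, 'b) mfps \<Rightarrow> ('a, 'b) mfps" where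
  "inverse_mfps f = (if f dvd 1 then THE g. f * g = 1 else 0)"

definition divide_mfps :: "('a, 'b) mfps \<Rightarrow> ('a, 'b) mfps \<Rightarrow> ('a, 'b) mfps" where
  "divide_mfps f g = f * inverse g"

instance ..

end

lemma mfps_inverse_unique:
  fixes f g :: "('v, 'a :: comm_ring_1) mfps"
  assumes "f * g = 1"
  shows "inverse f = g"
proof -
  have "h = g" if "f * h = 1" for h
  proof -
    have "h = (f * g) * h"
      by (simp add: assms)
    also have "\<dots> = (f * h) * g"
      by (simp only: ac_simps)
    finally show ?thesis
      by (simp add: that)
  qed
  then have "(THE h. f * h = 1) = g"
    using assms by (intro the_equality)
  moreover have "f dvd 1"
    by (metis assms dvd_triv_left)
  ultimately show ?thesis
    by (simp add: inverse_mfps_def)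
qed

lemma mfps_coeff_power_eq_0:
  fixes f :: "('v, 'a :: comm_ring_1) mfps"
  assumes "mfps_coeff f 0 = 0" and "Sum_any (Poly_Mapping.lookup x) < k"
  shows "mfps_coeff (f ^ k) x = 0"
  using assms(2)
proof (induction k arbitrary: x)
  case (Suc k)
  have "mfps_coeff f a * mfps_coeff (f ^ k) b = 0" if ab: "a + b = x" for a b
  proof (cases "a = 0")
    case False
    have deg: "Sum_any (Poly_Mapping.lookup x) =
        Sum_any (Poly_Mapping.lookup a) + Sum_any (Poly_Mapping.lookup b)"
      unfolding ab [symmetric] lookup_add by (rule Sum_any.distrib) simp_all
    from False have "Poly_Mapping.keys a \<noteq> {}"
      by simp
    then obtain v where "v \<in> Poly_Mapping.keys a"
      by blast
    then have "Sum_any (Poly_Mapping.lookup a) \<noteq> 0"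
      by (auto simp: Sum_any.expand_set in_keys_iff)
    with deg Suc.prems have "Sum_any (Poly_Mapping.lookup b) < k"
      by linarith
    then show ?thesis
      by (simp add: Suc.IH)
  qed (simp add: assms(1))
  then show ?case
    by (auto simp: times_mfps.rep_eq intro!: sum.neutral)
qed simp

lemma mfps_one_minus_inverse:
  fixes f :: "('v, 'a :: comm_ring_1) mfps"
  assumes "mfps_coeff f 0 = 0"
  shows "(1 - f) * inverse (1 - f) = 1"
proof -
  define g where
    "g = Abs_mfps (\<lambda>x. mfps_coeff (\<Sum>k<Suc (Sum_any (Poly_Mapping.lookup x)). f ^ k) x)"
  have coeff_sum: "mfps_coeff (sum F A) x = (\<Sum>k\<in>A. mfps_coeff (F k) x)"
    for F :: "nat \<Rightarrow> ('v, 'a) mfps" and A x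
    by (induction A rule: infinite_finite_induct) (simp_all add: zero_mfps.rep_eq plus_mfps.rep_eq)
  have "(1 - f) * g = 1"
  proof (rule mfps_eqI)
    fix x
    let ?d = "\<lambda>x :: 'v \<Rightarrow>\<^sub>0 nat. Sum_any (Poly_Mapping.lookup x)"
    let ?s = "\<Sum>k<Suc (?d x). f ^ k"
    have "mfps_coeff g b = mfps_coeff ?s b" if "a + b = x" for a b
    proof -
      have "?d x = ?d a + ?d b"
        unfolding that [symmetric] lookup_add by (rule Sum_any.distrib) simp_all
      then show ?thesis
        unfolding g_def mfps_coeff_Abs coeff_sum
        by (intro sum.mono_neutral_left) (auto intro: mfps_coeff_power_eq_0 [OF assms])
    qed
    then have "mfps_coeff ((1 - f) * g) x = mfps_coeff ((1 - f) * ?s) x"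
      unfolding times_mfps.rep_eq by (intro sum.cong) auto
    also have "(1 - f) * ?s = 1 - f ^ Suc (?d x)"
      by (rule one_diff_power_eq [symmetric])
    also have "mfps_coeff \<dots> x = mfps_coeff 1 x"
      by (simp only: minus_mfps.rep_eq mfps_coeff_power_eq_0 [OF assms lessI] diff_zero)
    finally show "mfps_coeff ((1 - f) * g) x = mfps_coeff 1 x" .
  qed
  then show ?thesis
    by (simp add: mfps_inverse_unique)
qed

text \<open>
  The topology is that of coefficientwise convergence (the product topology for discrete
  coefficients), so that \<^const>\<open>sums\<close> is summation of formal power series.
\<close>

instantiation mfps :: (type, comm_ring_1) topological_space
begin

definition open_mfps :: "('a, 'b) mfps set \<Rightarrow> bool" where
  "open_mfps U \<longleftrightarrow> (\<forall>f\<in>U. \<exists>X. finite X \<and>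
     (\<forall>g. (\<forall>x\<in>X. mfps_coeff g x = mfps_coeff f x) \<longrightarrow> g \<in> U))"

instance
proof
  show "open (UNIV :: ('a, 'b) mfps set)"
    by (auto simp: open_mfps_def)
next
  fix S T :: "('a, 'b) mfps set"
  assume S: "open S" and T: "open T"
  show "open (S \<inter> T)"
    unfolding open_mfps_def
  proof
    fix f assume "f \<in> S \<inter> T"
    with S T obtain X Y
      where "finite X" "\<And>g. (\<forall>x\<in>X. mfps_coeff g x = mfps_coeff f x) \<Longrightarrow> g \<in> S"
        and "finite Y" "\<And>g. (\<forall>x\<in>Y. mfps_coeff g x = mfps_coeff f x) \<Longrightarrow> g \<in> T"
      unfolding open_mfps_def by (metis IntE)
    then show "\<exists>X. finite X \<and> (\<forall>g. (\<forall>x\<in>X. mfps_coeff g x = mfps_coeff f x) \<longrightarrow> g \<in> S \<inter> T)"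
      by (intro exI [of _ "X \<union> Y"]) auto
  qed
next
  fix K :: "('a, 'b) mfps set set"
  assume "\<forall>S\<in>K. open S"
  then show "open (\<Union>K)"
    unfolding open_mfps_def by (meson UnionE UnionI)
qed

end

lemma mfps_open_coeff: "open {g :: ('v, 'a :: comm_ring_1) mfps. mfps_coeff g x = c}"
  unfolding open_mfps_def by (auto intro!: exI [of _ "{x}"])

instance mfps :: (type, comm_ring_1) t2_space
proof
  fix f g :: "('a, 'b) mfps"
  assume "f \<noteq> g"
  then obtain x where x: "mfps_coeff f x \<noteq> mfps_coeff g x"
    by (meson mfps_eqI)
  show "\<exists>U V. open U \<and> open V \<and> f \<in> U \<and> g \<in> V \<and> U \<inter> V = {}"
    by (rule exI [of _ "{h. mfps_coeff h x = mfps_coeff f x}"],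
        rule exI [of _ "{h. mfps_coeff h x = mfps_coeff g x}"])
      (use x in \<open>auto simp: mfps_open_coeff\<close>)
qed

lemma mfps_tendsto_iff:
  fixes F :: "'b \<Rightarrow> ('v, 'a :: comm_ring_1) mfps"
  shows "(F \<longlongrightarrow> f) net \<longleftrightarrow> (\<forall>x. \<forall>\<^sub>F t in net. mfps_coeff (F t) x = mfps_coeff f x)"
proof
  assume "(F \<longlongrightarrow> f) net"
  then show "\<forall>x. \<forall>\<^sub>F t in net. mfps_coeff (F t) x = mfps_coeff f x"
    by (auto dest: topological_tendstoD [OF _ mfps_open_coeff])
next
  assume *: "\<forall>x. \<forall>\<^sub>F t in net. mfps_coeff (F t) x = mfps_coeff f x"
  show "(F \<longlongrightarrow> f) net"
  proof (rule topological_tendstoI)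
    fix S assume "open S" "f \<in> S"
    then obtain X where "finite X"
      and X: "\<And>g. (\<forall>x\<in>X. mfps_coeff g x = mfps_coeff f x) \<Longrightarrow> g \<in> S"
      unfolding open_mfps_def by blast
    from \<open>finite X\<close> * have "\<forall>\<^sub>F t in net. \<forall>x\<in>X. mfps_coeff (F t) x = mfps_coeff f x"
      by (simp add: eventually_ball_finite)
    then show "\<forall>\<^sub>F t in net. F t \<in> S"
      by (rule eventually_mono) (rule X)
  qed
qed


section \<open>Gaussian binomial coefficients\<close>

definition gauss_binomial :: "nat \<Rightarrow> nat \<Rightarrow> 'a :: {comm_ring_1, inverse} \<Rightarrow> 'a" where
  "gauss_binomial N M q = (\<Prod>i=1..M. (1 - q ^ (N - M + i)) / (1 - q ^ i))"


section \<open>Colored multiset permutations\<close>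

text \<open>A pair \<^term>\<open>(k, c)\<close> stands for the letter \<open>k\<close> with color \<open>c\<close>.\<close>

type_synonym colored_word = "(nat \<times> nat) list"

definition colored_multiset_perms :: "nat \<Rightarrow> (nat \<Rightarrow> nat) \<Rightarrow> nat \<Rightarrow> colored_word set" where
  "colored_multiset_perms n m r =
     {w. set w \<subseteq> {1..n} \<times> {1..r} \<and> (\<forall>k\<in>{1..n}. count_list (map fst w) k = m k)}"

lemma length_colored_multiset_perms:
  assumes "w \<in> colored_multiset_perms n m r"
  shows "length w = (\<Sum>k=1..n. m k)"
proof -
  from assms have "set (map fst w) \<subseteq> {1..n}"
    by (auto simp: colored_multiset_perms_def)
  then have "(\<Sum>k=1..n. count_list (map fst w) k) = length (map fst w)"
    by (intro sum_count_set) simp_all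
  with assms show ?thesis
    by (simp add: colored_multiset_perms_def)
qed

lemma finite_colored_multiset_perms: "finite (colored_multiset_perms n m r)"
proof (rule finite_subset)
  show "colored_multiset_perms n m r \<subseteq>
      {w. set w \<subseteq> {1..n} \<times> {1..r} \<and> length w = (\<Sum>k=1..n. m k)}"
    using length_colored_multiset_perms by (auto simp: colored_multiset_perms_def)
qed (simp add: finite_lists_length_eq)

text \<open>
  Positions are counted from 1, and position \<^term>\<open>length w + 1\<close> holds the appended letter
  \<open>n + 1\<close> of color 1.
\<close>

definition colored_letter :: "nat \<Rightarrow> colored_word \<Rightarrow> nat \<Rightarrow> nat \<times> nat" where
  "colored_letter n w j = (w @ [(n + 1, 1)]) ! (j - 1)"

fun color_less :: "nat \<times> nat \<Rightarrow> nat \<times> nat \<Rightarrow> bool" where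
  "color_less (k, c) (l, d) \<longleftrightarrow> c < d \<or> c = d \<and> k < l"

definition DES :: "nat \<Rightarrow> colored_word \<Rightarrow> nat set" where
  "DES n w = {j \<in> {1..length w}. color_less (colored_letter n w (j + 1)) (colored_letter n w j)}"

definition color_change :: "nat \<Rightarrow> nat \<Rightarrow> colored_word \<Rightarrow> nat \<Rightarrow> nat" where
  "color_change n r w j =
     nat ((int (snd (colored_letter n w j)) - int (snd (colored_letter n w (j + 1)))) mod int r)"

text \<open>The monomial \<open>z\<^sub>0 z\<^bsub>\<pi>\<^sub>1\<^esub> \<cdots> z\<^bsub>\<pi>\<^sub>i\<^esub>\<close>.\<close>

definition prefix_monom :: "nat \<Rightarrow> colored_word \<Rightarrow> nat \<Rightarrow> (nat, 'a :: comm_ring_1) mfps" where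
  "prefix_monom n w i = mfps_var 0 * (\<Prod>j=1..i. mfps_var (fst (colored_letter n w j)))"

end

theory Submission
  imports Defs "HOL-Analysis.Infinite_Sum" "HOL-Library.Multiset" "HOL-Library.Product_Lexorder"
begin

text \<open>
  Expanding the geometric series, the summand of a word \<open>w\<close> is the sum of the monomials
  \<open>z\<^sub>0\<^sup>t \<Prod>\<^sub>j y\<^sub>j\<close>, \<open>y\<^sub>j\<close> being the \<open>f\<^sub>j\<close>-th power of the variable of the letter \<open>\<pi>\<^sub>j\<close>, where \<open>t = e\<^sub>0 + \<dots> + e\<^sub>M\<close> and
  \<open>f\<^sub>j = e\<^sub>j + \<dots> + e\<^sub>M\<close> for exponents \<open>e\<^sub>j \<equiv> a\<^sub>j (mod r)\<close> which are positive at the descents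
  with \<open>a\<^sub>j = 0\<close>. Since \<open>a\<^sub>j \<equiv> c\<^sub>j - c\<^sub>j\<^sub>+\<^sub>1\<close> and the last color is 1, this says that
  \<open>c\<^sub>j = 1 + f\<^sub>j mod r\<close> and that \<open>\<pi>\<^sub>j \<le> \<pi>\<^sub>j\<^sub>+\<^sub>1\<close> whenever \<open>f\<^sub>j = f\<^sub>j\<^sub>+\<^sub>1\<close>. So the colors are redundant and
  the list of the pairs \<open>(f\<^sub>j, \<pi>\<^sub>j)\<close> is an arbitrary multiset of pairs sorted by decreasing
  \<open>f\<close> and then by increasing letter, with \<open>m\<^sub>k\<close> entries in \<open>{0..t}\<close> for each letter \<open>k\<close>.
  Such multisets are counted by the product of Gaussian binomials.
\<close>

section \<open>Infinite sums of formal power series\<close>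

lemma mfps_coeff_sum: "mfps_coeff (sum F A) x = (\<Sum>i\<in>A. mfps_coeff (F i) x)"
  by (induction A rule: infinite_finite_induct) (simp_all add: zero_mfps.rep_eq plus_mfps.rep_eq)

text \<open>The topology is that of discrete coefficients, so convergence along finite subsets means
  that each coefficient of the partial sums is eventually constant. Adding one more index to a set
  \<open>K\<close> past which it is constant shows that the terms outside \<open>K\<close>
  contribute nothing.\<close>

lemma mfps_has_sum_iff:
  fixes g :: "'i \<Rightarrow> ('v, 'a :: comm_ring_1) mfps"
  shows "(g has_sum s) I \<longleftrightarrow>
    (\<forall>x. finite {i\<in>I. mfps_coeff (g i) x \<noteq> 0} \<and>
         mfps_coeff s x = (\<Sum>i | i \<in> I \<and> mfps_coeff (g i) x \<noteq> 0. mfps_coeff (g i) x))"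
    (is "_ \<longleftrightarrow> (\<forall>x. ?P x)")
proof -
  have "?P x \<longleftrightarrow> (\<forall>\<^sub>F K in finite_subsets_at_top I. mfps_coeff (sum g K) x = mfps_coeff s x)" for x
  proof -
    let ?N = "{i\<in>I. mfps_coeff (g i) x \<noteq> 0}"
    show ?thesis
    proof
      assume P: "?P x"
      have "mfps_coeff (sum g Y) x = mfps_coeff s x" if "finite Y" "?N \<subseteq> Y" "Y \<subseteq> I" for Y
        unfolding mfps_coeff_sum conjunct2[OF P]
        by (rule sum.mono_neutral_right) (use that in auto)
      with P show "\<forall>\<^sub>F K in finite_subsets_at_top I. mfps_coeff (sum g K) x = mfps_coeff s x"
        unfolding eventually_finite_subsets_at_top by (intro exI[of _ ?N]) auto
    next
      assume "\<forall>\<^sub>F K in finite_subsets_at_top I. mfps_coeff (sum g K) x = mfps_coeff s x"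
      then obtain K where K: "finite K" "K \<subseteq> I"
        and *: "\<forall>Y. finite Y \<and> K \<subseteq> Y \<and> Y \<subseteq> I \<longrightarrow> mfps_coeff (sum g Y) x = mfps_coeff s x"
        unfolding eventually_finite_subsets_at_top by (elim exE conjE) (rule that)
      have "mfps_coeff (g i) x = 0" if "i \<in> I" "i \<notin> K" for i
      proof -
        have "mfps_coeff (sum g (insert i K)) x = mfps_coeff (sum g K) x"
          using *[THEN spec, of K] *[THEN spec, of "insert i K"] K that subset_insertI[of K i] by simp
        then show ?thesis
          using K that by (simp add: plus_mfps.rep_eq)
      qed
      then have sub: "?N \<subseteq> K"
        by blast
      have "mfps_coeff s x = mfps_coeff (sum g K) x"
        using *[THEN spec, of K] K by simp
      also have "\<dots> = (\<Sum>i\<in>?N. mfps_coeff (g i) x)"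
        unfolding mfps_coeff_sum by (rule sum.mono_neutral_right) (use K sub in auto)
      finally show "?P x"
        using finite_subset[OF sub \<open>finite K\<close>] by blast
    qed
  qed
  then show ?thesis
    unfolding has_sum_def mfps_tendsto_iff by simp
qed

text \<open>Any finite set containing the support will do, so one index set can serve many monomials
  at once.\<close>

lemma mfps_has_sum_coeff:
  fixes g :: "'i \<Rightarrow> ('v, 'a :: comm_ring_1) mfps"
  assumes "(g has_sum s) I" "finite K" "K \<subseteq> I" "{i\<in>I. mfps_coeff (g i) x \<noteq> 0} \<subseteq> K"
  shows "mfps_coeff s x = (\<Sum>i\<in>K. mfps_coeff (g i) x)"
proof -
  have "mfps_coeff s x = (\<Sum>i | i \<in> I \<and> mfps_coeff (g i) x \<noteq> 0. mfps_coeff (g i) x)"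
    using assms(1) by (simp add: mfps_has_sum_iff)
  also have "\<dots> = (\<Sum>i\<in>K. mfps_coeff (g i) x)"
    by (rule sum.mono_neutral_left) (use assms(2-4) in auto)
  finally show ?thesis .
qed

lemma mfps_has_sumI:
  fixes g :: "'i \<Rightarrow> ('v, 'a :: comm_ring_1) mfps"
  assumes "\<And>x. \<exists>K. finite K \<and> K \<subseteq> I \<and> {i\<in>I. mfps_coeff (g i) x \<noteq> 0} \<subseteq> K \<and>
    mfps_coeff s x = (\<Sum>i\<in>K. mfps_coeff (g i) x)"
  shows "(g has_sum s) I"
  unfolding mfps_has_sum_iff
proof (intro allI)
  fix x
  obtain K where K: "finite K" "K \<subseteq> I" "{i\<in>I. mfps_coeff (g i) x \<noteq> 0} \<subseteq> K"
    "mfps_coeff s x = (\<Sum>i\<in>K. mfps_coeff (g i) x)"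
    using assms by blast
  have "(\<Sum>i\<in>K. mfps_coeff (g i) x) = (\<Sum>i | i \<in> I \<and> mfps_coeff (g i) x \<noteq> 0. mfps_coeff (g i) x)"
    by (rule sum.mono_neutral_right) (use K in auto)
  with K show "finite {i\<in>I. mfps_coeff (g i) x \<noteq> 0} \<and>
      mfps_coeff s x = (\<Sum>i | i \<in> I \<and> mfps_coeff (g i) x \<noteq> 0. mfps_coeff (g i) x)"
    using finite_subset by auto
qed

text \<open>A monomial splits in only finitely many ways, so each coefficient of the product
  involves finitely many pairs of terms and the Cauchy product can be rearranged as a finite
  sum.\<close>

lemma mfps_has_sum_mult:
  fixes g :: "'i \<Rightarrow> ('v, 'a :: comm_ring_1) mfps"
  assumes g: "(g has_sum s) I" and h: "(h has_sum t) J"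
  shows "((\<lambda>(i, j). g i * h j) has_sum (s * t)) (I \<times> J)"
proof (rule mfps_has_sumI)
  fix x :: "'v \<Rightarrow>\<^sub>0 nat"
  let ?S = "{(a, b). a + b = x}"
  \<comment> \<open>\<open>K\<close> and \<open>L\<close> hold every index that contributes to some
    splitting of \<open>x\<close>.\<close>
  define K where "K = (\<Union>p\<in>?S. {i\<in>I. mfps_coeff (g i) (fst p) \<noteq> 0})"
  define L where "L = (\<Union>p\<in>?S. {j\<in>J. mfps_coeff (h j) (snd p) \<noteq> 0})"
  have fin: "finite K" "finite L"
    unfolding K_def L_def using g h by (auto simp: mfps_has_sum_iff)
  have sub: "K \<subseteq> I" "L \<subseteq> J"
    by (auto simp: K_def L_def)
  have "mfps_coeff (s * t) x = (\<Sum>(a, b)\<in>?S. (\<Sum>i\<in>K. mfps_coeff (g i) a) * (\<Sum>j\<in>L. mfps_coeff (h j) b))"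
    unfolding times_mfps.rep_eq
  proof (intro sum.cong refl, clarify)
    fix a b assume "x = a + b"
    then have ab: "(a, b) \<in> ?S"
      by simp
    have "mfps_coeff s a = (\<Sum>i\<in>K. mfps_coeff (g i) a)"
      by (rule mfps_has_sum_coeff[OF g fin(1) sub(1)]) (use ab in \<open>force simp: K_def\<close>)
    moreover have "mfps_coeff t b = (\<Sum>j\<in>L. mfps_coeff (h j) b)"
      by (rule mfps_has_sum_coeff[OF h fin(2) sub(2)]) (use ab in \<open>force simp: L_def\<close>)
    ultimately show "mfps_coeff s a * mfps_coeff t b =
        (\<Sum>i\<in>K. mfps_coeff (g i) a) * (\<Sum>j\<in>L. mfps_coeff (h j) b)"
      by simp
  qed
  also have "\<dots> = (\<Sum>(i, j)\<in>K \<times> L. mfps_coeff (g i * h j) x)"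
    unfolding times_mfps.rep_eq sum_product sum.cartesian_product
    by (simp only: split_def) (rule sum.swap)
  finally have eq: "mfps_coeff (s * t) x = (\<Sum>p\<in>K \<times> L. mfps_coeff (case p of (i, j) \<Rightarrow> g i * h j) x)"
    by (simp add: split_def)
  have "mfps_coeff (g i * h j) x = 0" if "(i, j) \<in> I \<times> J - K \<times> L" for i j
    unfolding times_mfps.rep_eq
  proof (intro sum.neutral ballI, clarify)
    fix a b assume "x = a + b"
    then have "(a, b) \<in> ?S"
      by simp
    with that show "mfps_coeff (g i) a * mfps_coeff (h j) b = 0"
      unfolding K_def L_def by force
  qed
  then have "{p \<in> I \<times> J. mfps_coeff (case p of (i, j) \<Rightarrow> g i * h j) x \<noteq> 0} \<subseteq> K \<times> L"
    by auto
  with eq fin sub show "\<exists>K. finite K \<and> K \<subseteq> I \<times> J \<and>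
      {p \<in> I \<times> J. mfps_coeff (case p of (i, j) \<Rightarrow> g i * h j) x \<noteq> 0} \<subseteq> K \<and>
      mfps_coeff (s * t) x = (\<Sum>p\<in>K. mfps_coeff (case p of (i, j) \<Rightarrow> g i * h j) x)"
    by (intro exI[of _ "K \<times> L"]) auto
qed

lemma mfps_has_sum_cmult:
  fixes g :: "'i \<Rightarrow> ('v, 'a :: comm_ring_1) mfps"
  assumes "(g has_sum s) I"
  shows "((\<lambda>i. c * g i) has_sum (c * s)) I"
proof -
  have "((\<lambda>_. c) has_sum c) {()}"
    by (rule has_sum_finiteI) simp_all
  from mfps_has_sum_mult[OF this assms]
  have "((\<lambda>(u, i). c * g i) has_sum (c * s)) ({()} \<times> I)" .
  also have "?this \<longleftrightarrow> ?thesis"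
    by (rule has_sum_reindex_bij_witness[of _ "\<lambda>i. ((), i)" snd]) auto
  finally show ?thesis .
qed

text \<open>Distributivity of a finite product over infinite sums, by induction with the product
  rule: a choice function on \<open>insert a A\<close> is its value at \<open>a\<close> together
  with its restriction to \<open>A\<close>.\<close>

lemma mfps_has_sum_prod_PiE:
  fixes g :: "'b \<Rightarrow> 'i \<Rightarrow> ('v, 'a :: comm_ring_1) mfps"
  assumes "finite A" "\<And>a. a \<in> A \<Longrightarrow> (g a has_sum s a) (J a)"
  shows "((\<lambda>e. \<Prod>a\<in>A. g a (e a)) has_sum (\<Prod>a\<in>A. s a)) (PiE A J)"
  using assms
proof (induction A rule: finite_induct)
  case empty
  show ?case
    by (rule has_sum_finiteI) simp_all
next
  case (insert a A)
  have "((\<lambda>(y, e). g a y * (\<Prod>b\<in>A. g b (e b))) has_sum (s a * (\<Prod>b\<in>A. s b))) (J a \<times> PiE A J)"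
    by (rule mfps_has_sum_mult) (use insert in auto)
  also have "?this \<longleftrightarrow> ((\<lambda>e. \<Prod>b\<in>insert a A. g b (e b)) has_sum (\<Prod>b\<in>insert a A. s b)) (PiE (insert a A) J)"
  \<comment> \<open>Members of \<open>PiE A J\<close> are \<open>undefined\<close> off
    \<open>A\<close>, so restricting means resetting the value at \<open>a\<close>.\<close>
  proof (rule has_sum_reindex_bij_witness[of _ "\<lambda>e. (e a, e(a := undefined))" "\<lambda>(y, e). e(a := y)"])
    fix p assume "p \<in> J a \<times> PiE A J"
    then obtain y e where p: "p = (y, e)" "y \<in> J a" "e \<in> PiE A J"
      by auto
    have "e a = undefined"
      using p insert.hyps by (auto simp: PiE_def extensional_def)
    then show "(((case p of (y, e) \<Rightarrow> e(a := y)) a), (case p of (y, e) \<Rightarrow> e(a := y))(a := undefined)) = p"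
      by (auto simp: p)
    show "(case p of (y, e) \<Rightarrow> e(a := y)) \<in> PiE (insert a A) J"
      using p by (auto simp: PiE_def extensional_def Pi_def)
    have "(\<Prod>b\<in>A. g b ((e(a := y)) b)) = (\<Prod>b\<in>A. g b (e b))"
      by (rule prod.cong) (use insert.hyps in auto)
    then show "(\<Prod>b\<in>insert a A. g b ((case p of (y, e) \<Rightarrow> e(a := y)) b)) =
        (case p of (y, e) \<Rightarrow> g a y * (\<Prod>b\<in>A. g b (e b)))"
      using insert.hyps by (simp add: p)
  next
    fix e assume "e \<in> PiE (insert a A) J"
    then show "(e a, e(a := undefined)) \<in> J a \<times> PiE A J"
      using insert.hyps by (auto simp: PiE_def extensional_def Pi_def)
  qed (use insert.hyps in auto)
  finally show ?case .
qed

text \<open>Glues the expansions of finitely many words into one sum over pairs: a finite union of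
  finite supports is finite.\<close>

lemma mfps_has_sum_Sigma_finite:
  fixes g :: "'w \<times> 'i \<Rightarrow> ('v, 'a :: comm_ring_1) mfps"
  assumes "finite W" "\<And>w. w \<in> W \<Longrightarrow> ((\<lambda>i. g (w, i)) has_sum s w) (I w)"
  shows "(g has_sum (\<Sum>w\<in>W. s w)) (Sigma W I)"
proof (rule mfps_has_sumI)
  fix x
  let ?N = "\<lambda>w. {i\<in>I w. mfps_coeff (g (w, i)) x \<noteq> 0}"
  have fin: "finite (?N w)" if "w \<in> W" for w
    using assms(2)[OF that] by (simp add: mfps_has_sum_iff)
  have "mfps_coeff (\<Sum>w\<in>W. s w) x = (\<Sum>w\<in>W. \<Sum>i\<in>?N w. mfps_coeff (g (w, i)) x)"
    unfolding mfps_coeff_sum using assms(2) by (intro sum.cong) (auto simp: mfps_has_sum_iff)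
  also have "\<dots> = (\<Sum>p\<in>Sigma W ?N. mfps_coeff (g p) x)"
    using assms(1) fin by (subst sum.Sigma) auto
  finally show "\<exists>K. finite K \<and> K \<subseteq> Sigma W I \<and> {p \<in> Sigma W I. mfps_coeff (g p) x \<noteq> 0} \<subseteq> K \<and>
      mfps_coeff (\<Sum>w\<in>W. s w) x = (\<Sum>p\<in>K. mfps_coeff (g p) x)"
    using assms(1) fin by (intro exI[of _ "Sigma W ?N"]) auto
qed

text \<open>Passes from an unordered sum to a series graded by \<open>t\<close>: the finite support
  of a coefficient meets only finitely many slices, so the partial sums stabilise.\<close>

lemma mfps_has_sum_imp_sums:
  fixes g :: "nat \<times> 'i \<Rightarrow> ('v, 'a :: comm_ring_1) mfps"
  assumes g: "(g has_sum s) (Sigma UNIV I)" and fin: "\<And>t. finite (I t)"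
  shows "(\<lambda>t. \<Sum>i\<in>I t. g (t, i)) sums s"
  unfolding sums_def mfps_tendsto_iff
proof
  fix x
  let ?N = "{p \<in> Sigma UNIV I. mfps_coeff (g p) x \<noteq> 0}"
  have "finite (fst ` ?N)"
    using g by (simp add: mfps_has_sum_iff)
  then obtain T where T: "\<And>t. t \<in> fst ` ?N \<Longrightarrow> t < T"
    unfolding finite_nat_set_iff_bounded by (elim exE) (rule that, rule bspec)
  show "\<forall>\<^sub>F n in sequentially. mfps_coeff (\<Sum>t<n. \<Sum>i\<in>I t. g (t, i)) x = mfps_coeff s x"
    unfolding eventually_sequentially
  proof (intro exI allI impI)
    fix n assume n: "T \<le> n"
    have "mfps_coeff s x = (\<Sum>p\<in>Sigma {..<n} I. mfps_coeff (g p) x)"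
    proof (rule mfps_has_sum_coeff[OF g])
      show "finite (Sigma {..<n} I)"
        using fin by auto
      show "?N \<subseteq> Sigma {..<n} I"
      proof
        fix p assume p: "p \<in> ?N"
        then have "fst p < n"
          using T[of "fst p"] n by fastforce
        with p show "p \<in> Sigma {..<n} I"
          by auto
      qed
    qed auto
    also have "\<dots> = mfps_coeff (\<Sum>t<n. \<Sum>i\<in>I t. g (t, i)) x"
      unfolding mfps_coeff_sum using fin by (subst sum.Sigma) auto
    finally show "mfps_coeff (\<Sum>t<n. \<Sum>i\<in>I t. g (t, i)) x = mfps_coeff s x" ..
  qed
qed

lemma mfps_has_sum_geometric:
  fixes p :: "('v, 'a :: comm_ring_1) mfps"
  assumes "mfps_coeff p 0 = 0"
  shows "((\<lambda>k. p ^ k) has_sum inverse (1 - p)) UNIV"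
proof (rule mfps_has_sumI)
  fix x :: "'v \<Rightarrow>\<^sub>0 nat"
  let ?d = "\<lambda>x :: 'v \<Rightarrow>\<^sub>0 nat. Sum_any (Poly_Mapping.lookup x)"
  let ?K = "{..<Suc (?d x)}"
  \<comment> \<open>The remainder of the truncated geometric series is a multiple of a power of
    \<open>p\<close> exceeding the degree of \<open>x\<close>; as \<open>p\<close> has no constant
    term, it does not reach the coefficient at \<open>x\<close>.\<close>
  have "inverse (1 - p) = (\<Sum>k\<in>?K. p ^ k) + p ^ Suc (?d x) * inverse (1 - p)"
  proof -
    have "1 = (\<Sum>k\<in>?K. p ^ k) * (1 - p) + p ^ Suc (?d x)"
      by (subst mult.commute) (simp only: one_diff_power_eq [symmetric] diff_add_cancel)
    then have "1 * inverse (1 - p) = ((\<Sum>k\<in>?K. p ^ k) * (1 - p) + p ^ Suc (?d x)) * inverse (1 - p)"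
      by simp
    then show ?thesis
      using mfps_one_minus_inverse[OF assms] by (simp only: distrib_right mult.assoc mult_1_left mult_1_right)
  qed
  moreover have "mfps_coeff (p ^ Suc (?d x) * inverse (1 - p)) x = 0"
    unfolding times_mfps.rep_eq
  proof (intro sum.neutral ballI, clarify)
    fix a b assume ab: "x = a + b"
    have "?d (a + b) = ?d a + ?d b"
      unfolding lookup_add by (rule Sum_any.distrib) simp_all
    then show "mfps_coeff (p ^ Suc (?d (a + b))) a * mfps_coeff (inverse (1 - p)) b = 0"
      using mfps_coeff_power_eq_0[OF assms, of a "Suc (?d (a + b))"] by simp
  qed
  ultimately have "mfps_coeff (inverse (1 - p)) x = (\<Sum>k\<in>?K. mfps_coeff (p ^ k) x)"
    by (metis add.right_neutral mfps_coeff_sum plus_mfps.rep_eq)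
  moreover have "{k \<in> UNIV. mfps_coeff (p ^ k) x \<noteq> 0} \<subseteq> ?K"
    using mfps_coeff_power_eq_0[OF assms, of x] not_less_eq by (auto simp del: lessThan_Suc)
  ultimately show "\<exists>K. finite K \<and> K \<subseteq> UNIV \<and> {k \<in> UNIV. mfps_coeff (p ^ k) x \<noteq> 0} \<subseteq> K \<and>
      mfps_coeff (inverse (1 - p)) x = (\<Sum>k\<in>K. mfps_coeff (p ^ k) x)"
    by (intro exI[of _ ?K]) auto
qed

lemma mfps_coeff_mult_0:
  fixes f g :: "('v, 'a :: comm_ring_1) mfps"
  shows "mfps_coeff (f * g) 0 = mfps_coeff f 0 * mfps_coeff g 0"
proof -
  have "{(a, b). a + b = (0 :: 'v \<Rightarrow>\<^sub>0 nat)} = {(0, 0)}"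
  proof (rule set_eqI, clarify)
    fix a b :: "'v \<Rightarrow>\<^sub>0 nat"
    have "a = 0 \<and> b = 0" if "a + b = 0"
    proof -
      have "Poly_Mapping.lookup a v = 0 \<and> Poly_Mapping.lookup b v = 0" for v
        using arg_cong[OF that, of "\<lambda>p. Poly_Mapping.lookup p v"] by (simp add: lookup_add)
      then show ?thesis
        by (auto intro: poly_mapping_eqI)
    qed
    then show "(a, b) \<in> {(a, b). a + b = 0} \<longleftrightarrow> (a, b) \<in> {(0, 0)}"
      by auto
  qed
  then show ?thesis
    unfolding times_mfps.rep_eq by simp
qed

lemma mfps_coeff_power_0:
  assumes "mfps_coeff f 0 = 0" "k > 0"
  shows "mfps_coeff (f ^ k) 0 = 0"
  using assms by (cases k) (simp_all add: mfps_coeff_mult_0)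

lemma mfps_coeff_var_0 [simp]: "mfps_coeff (mfps_var (v :: 'v)) 0 = 0"
proof -
  have "(0 :: 'v \<Rightarrow>\<^sub>0 nat) \<noteq> Poly_Mapping.single v 1"
    by (metis lookup_single_eq lookup_zero zero_neq_one)
  then show ?thesis
    by (simp add: mfps_var_def)
qed

section \<open>Gaussian binomials and multisets\<close>

text \<open>Split by whether the largest admissible value \<open>Suc t\<close> occurs; if it does,
  remove one copy. With weights \<open>q ^ sum_mset A\<close> this is the q-Pascal
  recursion.\<close>

lemma sum_multisets_of_size_Suc:
  fixes f :: "nat multiset \<Rightarrow> 'a :: comm_monoid_add"
  shows "(\<Sum>A\<in>multisets_of_size {..Suc t} (Suc m). f A) =
    (\<Sum>A\<in>multisets_of_size {..t} (Suc m). f A) +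
    (\<Sum>A\<in>multisets_of_size {..Suc t} m. f (add_mset (Suc t) A))"
proof -
  have *: "multisets_of_size {..Suc t} (Suc m) =
      multisets_of_size {..t} (Suc m) \<union> add_mset (Suc t) ` multisets_of_size {..Suc t} m"
  proof (intro set_eqI iffI)
    fix A assume A: "A \<in> multisets_of_size {..Suc t} (Suc m)"
    show "A \<in> multisets_of_size {..t} (Suc m) \<union> add_mset (Suc t) ` multisets_of_size {..Suc t} m"
    proof (cases "Suc t \<in># A")
      case True
      then obtain B where "A = add_mset (Suc t) B"
        by (meson multi_member_split)
      with A show ?thesis
        by (auto simp: multisets_of_size_def)
    next
      case False
      have "x \<le> t" if "x \<in># A" for x
      proof -
        have "x \<le> Suc t" "x \<noteq> Suc t"
          using A that False by (auto simp: multisets_of_size_def)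
        then show ?thesis
          by simp
      qed
      with A show ?thesis
        by (auto simp: multisets_of_size_def)
    qed
  qed (auto simp: multisets_of_size_def le_SucI)
  have "multisets_of_size {..t} (Suc m) \<inter> add_mset (Suc t) ` multisets_of_size {..Suc t} m = {}"
    by (auto simp: multisets_of_size_def)
  moreover have "inj_on (add_mset (Suc t)) (multisets_of_size {..Suc t} m)"
    by (simp add: inj_on_def)
  ultimately show ?thesis
    unfolding * by (subst sum.union_disjoint) (simp_all add: finite_multisets_of_size sum.reindex)
qed

text \<open>The formula for the Gaussian binomial with denominators cleared, which makes sense in
  every commutative ring. Both sides satisfy the q-Pascal recursion, whence the nested inductions on
  \<open>t\<close> and \<open>m\<close>.\<close>

lemma prod_mult_sum_multisets_of_size:
  fixes q :: "'a :: comm_ring_1"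
  shows "(\<Prod>i=1..m. 1 - q ^ i) * (\<Sum>A\<in>multisets_of_size {..t} m. q ^ sum_mset A) =
    (\<Prod>i=1..m. 1 - q ^ (t + i))"
proof (induction t arbitrary: m)
  case 0
  have "multisets_of_size {..0 :: nat} m = {replicate_mset m 0}"
  proof (intro set_eqI iffI)
    fix A assume "A \<in> multisets_of_size {..0 :: nat} m"
    then show "A \<in> {replicate_mset m 0}"
      using set_mset_subset_singletonD[of A 0] by (simp add: multisets_of_size_def)
  qed (simp add: multisets_of_size_def)
  then show ?case
    by simp
next
  case (Suc t)
  note IH = Suc.IH
  show ?case
  proof (induction m)
    case 0
    show ?case
      by simp
  next
    case (Suc m)
    let ?H = "\<lambda>t m. \<Sum>A\<in>multisets_of_size {..t} m. q ^ sum_mset A"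
    let ?D = "\<lambda>m. \<Prod>i=1..m. 1 - q ^ i"
    let ?P = "\<Prod>i=1..m. 1 - q ^ (Suc t + i)"
    have "?H (Suc t) (Suc m) = ?H t (Suc m) + q ^ Suc t * ?H (Suc t) m"
      by (simp add: sum_multisets_of_size_Suc power_add sum_distrib_left mult.assoc)
    moreover have "?D (Suc m) = ?D m * (1 - q ^ Suc m)"
      by simp
    ultimately have "?D (Suc m) * ?H (Suc t) (Suc m) =
        ?D (Suc m) * ?H t (Suc m) + q ^ Suc t * (1 - q ^ Suc m) * (?D m * ?H (Suc t) m)"
      by (simp only: distrib_left mult_ac)
    also have "?D m * ?H (Suc t) m = ?P"
      by (rule Suc.IH)
    also have "?D (Suc m) * ?H t (Suc m) = (\<Prod>i=1..Suc m. 1 - q ^ (t + i))"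
      by (rule IH)
    \<comment> \<open>After the first factor is split off, an index shift exposes \<open>?P\<close>,
      the factor shared with the other summand.\<close>
    also have "\<dots> = (1 - q ^ Suc t) * (\<Prod>i=2..Suc m. 1 - q ^ (t + i))"
      by (subst prod.atLeast_Suc_atMost) (simp_all add: numeral_2_eq_2)
    also have "(\<Prod>i=2..Suc m. 1 - q ^ (t + i)) = ?P"
      using prod.shift_bounds_cl_Suc_ivl[of "\<lambda>i. 1 - q ^ (t + i)" 1 m] by (simp add: numeral_2_eq_2)
    also have "(1 - q ^ Suc t) * ?P + q ^ Suc t * (1 - q ^ Suc m) * ?P = ?P * (1 - q ^ (Suc t + Suc m))"
      by (simp add: algebra_simps power_add)
    also have "\<dots> = (\<Prod>i=1..Suc m. 1 - q ^ (Suc t + i))"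
      by simp
    finally show ?case .
  qed
qed

text \<open>Without constant term in \<open>q\<close>, each \<open>1 - q ^ i\<close> is a unit, and
  the cleared denominators can be divided out again.\<close>

lemma gauss_binomial_eq_sum_multisets:
  fixes q :: "('v, 'a :: comm_ring_1) mfps"
  assumes "mfps_coeff q 0 = 0"
  shows "gauss_binomial (t + m) m q = (\<Sum>A\<in>multisets_of_size {..t} m. q ^ sum_mset A)"
proof -
  let ?S = "\<Sum>A\<in>multisets_of_size {..t} m. q ^ sum_mset A"
  let ?D = "\<Prod>i=1..m. 1 - q ^ i"
  let ?R = "\<Prod>i=1..m. inverse (1 - q ^ i)"
  have "?D * ?R = 1"
    unfolding prod.distrib[symmetric]
    by (rule prod.neutral) (auto intro!: mfps_one_minus_inverse mfps_coeff_power_0 assms)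
  then have "?S = (?D * ?R) * ?S"
    by simp
  also have "\<dots> = (?D * ?S) * ?R"
    by (simp only: mult_ac)
  also have "?D * ?S = (\<Prod>i=1..m. 1 - q ^ (t + i))"
    by (rule prod_mult_sum_multisets_of_size)
  finally show ?thesis
    by (simp add: gauss_binomial_def divide_mfps_def prod.distrib)
qed

section \<open>Families of multisets as multisets of pairs\<close>

lemma filter_mset_sum: "filter_mset P (sum f A) = (\<Sum>a\<in>A. filter_mset P (f a))"
  by (induction A rule: infinite_finite_induct) simp_all

lemma prod_mset_image_sum: "prod_mset (image_mset g (sum f A)) = (\<Prod>a\<in>A. prod_mset (image_mset g (f a)))"
  by (induction A rule: infinite_finite_induct) simp_all

text \<open>A pair \<^term>\<open>(f, k)\<close> is an entry \<open>f\<close> of the \<open>k\<close>-th multiset.\<close>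

definition pair_multisets :: "nat set \<Rightarrow> nat set \<Rightarrow> (nat \<Rightarrow> nat) \<Rightarrow> (nat \<times> nat) multiset set" where
  "pair_multisets F K m =
     {B. set_mset B \<subseteq> F \<times> K \<and> (\<forall>k\<in>K. size (filter_mset (\<lambda>x. snd x = k) B) = m k)}"

text \<open>Tagging the entries of the \<open>k\<close>-th multiset with \<open>k\<close> loses
  nothing under merging, since filtering by the tag recovers each multiset.\<close>

lemma bij_betw_pair_multisets:
  assumes K: "finite K"
  shows "bij_betw (\<lambda>p. \<Sum>k\<in>K. image_mset (\<lambda>f. (f, k)) (p k))
    (PiE K (\<lambda>k. multisets_of_size F (m k))) (pair_multisets F K m)"
proof (rule bij_betwI)
  let ?J = "\<lambda>p. \<Sum>k\<in>K. image_mset (\<lambda>f. (f, k)) (p k)"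
  let ?I = "\<lambda>B. \<lambda>k\<in>K. image_mset fst (filter_mset (\<lambda>x. snd x = k) B)"
  have filter_J: "filter_mset (\<lambda>x. snd x = k) (?J p) = image_mset (\<lambda>f. (f, k)) (p k)"
    if "k \<in> K" for k p
  proof -
    have "filter_mset (\<lambda>x. snd x = k) (?J p) =
        (\<Sum>l\<in>K. if l = k then image_mset (\<lambda>f. (f, l)) (p l) else {#})"
      unfolding filter_mset_sum by (intro sum.cong) (auto simp: filter_mset_image_mset)
    also have "\<dots> = image_mset (\<lambda>f. (f, k)) (p k)"
      using K that by simp
    finally show ?thesis .
  qed
  show "?J \<in> PiE K (\<lambda>k. multisets_of_size F (m k)) \<rightarrow> pair_multisets F K m"
  proof
    fix p assume p: "p \<in> PiE K (\<lambda>k. multisets_of_size F (m k))"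
    then have *: "set_mset (p k) \<subseteq> F" "size (p k) = m k" if "k \<in> K" for k
      using PiE_mem[OF p that] by (simp_all add: multisets_of_size_def)
    have "set_mset (?J p) = (\<Union>k\<in>K. (\<lambda>f. (f, k)) ` set_mset (p k))"
      using K by (simp add: set_mset_sum)
    then have "set_mset (?J p) \<subseteq> F \<times> K"
      using *(1) by auto
    then show "?J p \<in> pair_multisets F K m"
      unfolding pair_multisets_def by (simp add: filter_J *(2))
  qed
  show "?I \<in> pair_multisets F K m \<rightarrow> PiE K (\<lambda>k. multisets_of_size F (m k))"
    by (fastforce simp: pair_multisets_def multisets_of_size_def)
  show "?I (?J p) = p" if "p \<in> PiE K (\<lambda>k. multisets_of_size F (m k))" for p
  proof
    fix k
    show "?I (?J p) k = p k"
      using that by (cases "k \<in> K") (simp_all add: filter_J multiset.map_comp comp_def PiE_def extensional_def)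
  qed
  show "?J (?I B) = B" if B: "B \<in> pair_multisets F K m" for B
  proof -
    have "?J (?I B) = (\<Sum>k\<in>K. filter_mset (\<lambda>x. snd x = k) B)"
    proof (rule sum.cong)
      fix k assume "k \<in> K"
      then have "image_mset (\<lambda>f. (f, k)) (?I B k) = image_mset (\<lambda>x. (fst x, k)) (filter_mset (\<lambda>x. snd x = k) B)"
        by (simp add: multiset.map_comp comp_def)
      also have "\<dots> = image_mset (\<lambda>x. x) (filter_mset (\<lambda>x. snd x = k) B)"
        by (rule image_mset_cong) auto
      finally show "image_mset (\<lambda>f. (f, k)) (?I B k) = filter_mset (\<lambda>x. snd x = k) B"
        by simp
    qed simp
    also have "\<dots> = B"
    proof (rule multiset_eqI)
      fix x
      have "count (\<Sum>k\<in>K. filter_mset (\<lambda>x. snd x = k) B) x = (\<Sum>k\<in>K. if snd x = k then count B x else 0)"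
        by (simp add: count_sum)
      also have "\<dots> = (if snd x \<in> K then count B x else 0)"
        using K by simp
      also have "\<dots> = count B x"
        using B by (auto simp: pair_multisets_def count_eq_zero_iff)
      finally show "count (\<Sum>k\<in>K. filter_mset (\<lambda>x. snd x = k) B) x = count B x" .
    qed
    finally show ?thesis .
  qed
qed

lemma finite_pair_multisets: "finite F \<Longrightarrow> finite K \<Longrightarrow> finite (pair_multisets F K m)"
  using bij_betw_finite[OF bij_betw_pair_multisets[of K F m]]
  by (simp add: finite_PiE finite_multisets_of_size)

text \<open>Expanding the product of multiset sums chooses one multiset per \<open>k\<close>; the
  weight is multiplicative, so it depends only on the merged multiset.\<close>

lemma prod_gauss_binomial_eq_sum:
  fixes q :: "nat \<Rightarrow> ('v, 'a :: comm_ring_1) mfps"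
  assumes "finite K" "\<And>k. k \<in> K \<Longrightarrow> mfps_coeff (q k) 0 = 0"
  shows "(\<Prod>k\<in>K. gauss_binomial (t + m k) (m k) (q k)) =
    (\<Sum>B\<in>pair_multisets {..t} K m. \<Prod>x\<in>#B. q (snd x) ^ fst x)"
proof -
  have pow: "q k ^ sum_mset A = (\<Prod>f\<in>#A. q k ^ f)" for k and A :: "nat multiset"
    by (induction A) (simp_all add: power_add)
  have "(\<Prod>k\<in>K. gauss_binomial (t + m k) (m k) (q k)) =
      (\<Prod>k\<in>K. \<Sum>A\<in>multisets_of_size {..t} (m k). q k ^ sum_mset A)"
    using assms(2) by (simp add: gauss_binomial_eq_sum_multisets)
  also have "\<dots> = (\<Sum>p\<in>PiE K (\<lambda>k. multisets_of_size {..t} (m k)). \<Prod>k\<in>K. q k ^ sum_mset (p k))"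
    using assms(1) by (subst prod_sum_PiE) (auto simp: finite_multisets_of_size)
  also have "\<dots> = (\<Sum>p\<in>PiE K (\<lambda>k. multisets_of_size {..t} (m k)).
      \<Prod>x\<in>#(\<Sum>k\<in>K. image_mset (\<lambda>f. (f, k)) (p k)). q (snd x) ^ fst x)"
    by (simp add: pow prod_mset_image_sum multiset.map_comp comp_def)
  also have "\<dots> = (\<Sum>B\<in>pair_multisets {..t} K m. \<Prod>x\<in>#B. q (snd x) ^ fst x)"
    by (rule sum.reindex_bij_betw[OF bij_betw_pair_multisets[OF assms(1)]])
  finally show ?thesis .
qed

text \<open>For an injective key, a multiset has exactly one sorted arrangement.\<close>

lemma bij_betw_mset_sorted_key:
  fixes key :: "'b \<Rightarrow> 'k :: linorder"
  assumes "inj key"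
  shows "bij_betw mset {xs. sorted (map key xs) \<and> mset xs \<in> \<B>} \<B>"
proof (rule bij_betwI')
  fix xs ys assume "xs \<in> {xs. sorted (map key xs) \<and> mset xs \<in> \<B>}"
    "ys \<in> {xs. sorted (map key xs) \<and> mset xs \<in> \<B>}"
  then have "sorted (map key xs)" "sorted (map key ys)"
    by auto
  then show "mset xs = mset ys \<longleftrightarrow> xs = ys"
    using sort_key_inj_key_eq[of _ _ key] inj_on_subset[OF assms subset_UNIV] by metis
next
  fix B assume "B \<in> \<B>"
  moreover obtain xs where "mset xs = B"
    using ex_mset by blast
  ultimately show "\<exists>xs\<in>{xs. sorted (map key xs) \<and> mset xs \<in> \<B>}. B = mset xs"
    by (intro bexI[of _ "sort_key key xs"]) auto
qed auto

section \<open>Words with exponents and sorted lists of pairs\<close>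

text \<open>One step of the color recursion: a color in \<open>{1..r}\<close> is determined by its
  residue, so prescribing the color change prescribes the color in terms of the next one.\<close>

lemma nat_mod_diff_eq_iff:
  fixes c c' e f r :: nat
  assumes "1 \<le> c" "c \<le> r" and c': "c' = 1 + f mod r"
  shows "nat ((int c - int c') mod int r) = e mod r \<longleftrightarrow> c = 1 + (f + e) mod r"
proof -
  have r: "r > 0"
    using assms by simp
  have "(int c - int c') mod int r \<ge> 0"
    using r by simp
  then have "nat ((int c - int c') mod int r) = e mod r \<longleftrightarrow>
      (int c - int c') mod int r = int e mod int r"
    by (metis int_nat_eq nat_int zmod_int)
  also have "\<dots> \<longleftrightarrow> int r dvd int c - int c' - int e"
    by (rule mod_eq_dvd_iff)
  \<comment> \<open>Adding a multiple of \<open>r\<close> replaces the residue hidden in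
    \<open>c'\<close> by \<open>f\<close> itself.\<close>
  also have "\<dots> \<longleftrightarrow> int r dvd (int c - int c' - int e) + (int f mod int r - int f)"
    by (rule dvd_add_left_iff[symmetric]) (simp flip: mod_eq_dvd_iff)
  also have "(int c - int c' - int e) + (int f mod int r - int f) = int (c - 1) - int (f + e)"
    using assms by (simp add: zmod_int)
  also have "int r dvd \<dots> \<longleftrightarrow> int (c - 1) mod int r = int (f + e) mod int r"
    by (rule mod_eq_dvd_iff[symmetric])
  also have "\<dots> \<longleftrightarrow> (c - 1) mod r = (f + e) mod r"
    by (simp only: zmod_int[symmetric] int_int_eq)
  also have "(c - 1) mod r = c - 1"
    using assms by simp
  also have "c - 1 = (f + e) mod r \<longleftrightarrow> c = 1 + (f + e) mod r"
    using assms by auto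
  finally show ?thesis .
qed

text \<open>The total exponent of the \<open>i\<close>-th prefix monomial in the numerator; the
  denominator only adds multiples of \<open>r\<close>.\<close>

definition least_exponent :: "nat \<Rightarrow> nat \<Rightarrow> colored_word \<Rightarrow> nat \<Rightarrow> nat" where
  "least_exponent n r w i =
     color_change n r w i + (if i \<in> DES n w \<and> color_change n r w i = 0 then r else 0)"

text \<open>The exponents of the \<open>i\<close>-th prefix monomial in the expansion of the summand of \<open>w\<close>;
  index 0 stands for the factor \<open>1 / (1 - z\<^sub>0)\<close>.\<close>

definition exponents :: "nat \<Rightarrow> nat \<Rightarrow> colored_word \<Rightarrow> nat \<Rightarrow> nat set" where
  "exponents n r w i = (if i = 0 then UNIV else range (\<lambda>j. least_exponent n r w i + r * j))"

text \<open>As the color change is below \<open>r\<close>, the progression consists of all exponents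
  with that residue, except that at a descent with color change 0 it starts at \<open>r\<close> and
  so omits exactly 0.\<close>

lemma mem_exponents_iff:
  assumes "r \<ge> 1" "i \<noteq> 0"
  shows "e \<in> exponents n r w i \<longleftrightarrow>
    color_change n r w i = e mod r \<and> (i \<in> DES n w \<and> color_change n r w i = 0 \<longrightarrow> e \<noteq> 0)"
    (is "?L \<longleftrightarrow> ?R")
proof -
  let ?a = "color_change n r w i"
  have a: "?a < r"
    using assms by (simp add: color_change_def nat_less_iff)
  show ?thesis
  proof
    assume ?L
    then obtain j where "e = least_exponent n r w i + r * j"
      using assms by (auto simp: exponents_def)
    with a assms show ?R
      by (auto simp: least_exponent_def)
  next
    assume R: ?R
    have e: "e = ?a + r * (e div r)"
      using R by simp
    show ?L
    proof (cases "i \<in> DES n w \<and> ?a = 0")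
      \<comment> \<open>One of the \<open>e div r\<close> multiples of \<open>r\<close> is already
        part of the least exponent.\<close>
      case True
      then have "e = r * (e div r)" and "e \<noteq> 0"
        using e R by simp_all
      then have "e div r \<noteq> 0"
        by (metis mult_0_right)
      then have "e div r = Suc (e div r - 1)"
        by simp
      with e True have "e = least_exponent n r w i + r * (e div r - 1)"
        by (metis add_0 least_exponent_def mult_Suc_right)
      then have "e \<in> range (\<lambda>j. least_exponent n r w i + r * j)"
        by (rule range_eqI)
      then show ?thesis
        using assms(2) by (simp only: exponents_def if_False)
    next
      case False
      then have "e = least_exponent n r w i + r * (e div r)"
        using e by (simp only: least_exponent_def if_False add_0_right)
      then have "e \<in> range (\<lambda>j. least_exponent n r w i + r * j)"
        by (rule range_eqI)
      then show ?thesis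
        using assms(2) by (simp only: exponents_def if_False)
    qed
  qed
qed

lemma colored_letter_Suc [simp]: "i < length w \<Longrightarrow> colored_letter n w (Suc i) = w ! i"
  by (simp add: colored_letter_def nth_append)

lemma colored_letter_end [simp]: "colored_letter n w (Suc (length w)) = (n + 1, 1)"
  by (simp add: colored_letter_def)

text \<open>Each color is determined by the next one and the exponent, so the colors are computed
  backwards from the appended letter, whose color 1 matches the empty tail sum.\<close>

lemma exponents_iff_tail_sums:
  assumes w: "w \<in> colored_multiset_perms n m r" and r: "r \<ge> 1" and M: "M = length w"
  shows "(\<forall>i\<in>{1..M}. e i \<in> exponents n r w i) \<longleftrightarrow>
    (\<forall>i\<in>{1..M}. snd (colored_letter n w i) = 1 + sum e {i..M} mod r \<and>
      (e i = 0 \<longrightarrow> fst (colored_letter n w i) \<le> fst (colored_letter n w (Suc i))))"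
    (is "(\<forall>i\<in>_. ?E i) \<longleftrightarrow> (\<forall>i\<in>_. ?C i \<and> ?O i)")
proof -
  have last: "?C (Suc M)"
    using M by simp
  have step: "?E i \<longleftrightarrow> ?C i \<and> ?O i" if i: "i \<in> {1..M}" and C: "?C (Suc i)" for i
  proof -
    obtain j where j: "i = Suc j" "j < length w"
      using i M by (cases i) auto
    have "w ! j \<in> {1..n} \<times> {1..r}"
      using w j nth_mem[of j w] unfolding colored_multiset_perms_def by blast
    then have c: "1 \<le> snd (colored_letter n w i)" "snd (colored_letter n w i) \<le> r"
      using j by auto
    have sum: "sum e {i..M} = sum e {Suc i..M} + e i"
      using i by (simp add: sum.atLeast_Suc_atMost)
    have cc: "color_change n r w i = e i mod r \<longleftrightarrow> ?C i"
      unfolding color_change_def sum using nat_mod_diff_eq_iff[OF c C] by simp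
    \<comment> \<open>For \<open>e i = 0\<close> neighbouring tail sums agree, hence so do the
      colors, and being a descent only compares the letters. For \<open>e i\<close> positive both
      sides hold trivially.\<close>
    have "(i \<in> DES n w \<and> color_change n r w i = 0 \<longrightarrow> e i \<noteq> 0) \<longleftrightarrow> ?O i" if Ci: "?C i"
    proof (cases "e i = 0")
      case True
      then have "snd (colored_letter n w i) = snd (colored_letter n w (Suc i))"
        using Ci C sum by simp
      then have "i \<in> DES n w \<longleftrightarrow> fst (colored_letter n w (Suc i)) < fst (colored_letter n w i)"
        using i M by (cases "colored_letter n w i"; cases "colored_letter n w (Suc i)") (simp add: DES_def)
      moreover have "color_change n r w i = 0"
        using cc Ci True by simp
      ultimately show ?thesis
        using True by auto
    qed simp
    then show ?thesis
      using mem_exponents_iff[of r i "e i" n w] r i cc by auto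
  qed
  show ?thesis
  proof
    assume E: "\<forall>i\<in>{1..M}. ?E i"
    \<comment> \<open>The downward induction starts at the appended letter; the guard excludes index
      0, which is not a position.\<close>
    have C: "1 \<le> i \<longrightarrow> ?C i" if "i \<le> Suc M" for i
      using that
    proof (rule inc_induct)
      fix i assume i: "i < Suc M" and IH: "1 \<le> Suc i \<longrightarrow> ?C (Suc i)"
      show "1 \<le> i \<longrightarrow> ?C i"
      proof
        assume "1 \<le> i"
        with i have i': "i \<in> {1..M}"
          by simp
        from IH have "?C (Suc i)"
          by simp
        from step[OF i' this] E i' show "?C i"
          by blast
      qed
    qed (use last in blast)
    show "\<forall>i\<in>{1..M}. ?C i \<and> ?O i"
    proof
      fix i assume i: "i \<in> {1..M}"
      then have "?C (Suc i)"
        using C[of "Suc i"] by simp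
      from step[OF i this] E i show "?C i \<and> ?O i"
        by blast
    qed
  next
    assume C: "\<forall>i\<in>{1..M}. ?C i \<and> ?O i"
    show "\<forall>i\<in>{1..M}. ?E i"
    proof
      fix i assume i: "i \<in> {1..M}"
      have "?C (Suc i)"
        using C i last by (cases "i = M") auto
      then show "?E i"
        using step[OF i] C i by blast
    qed
  qed
qed

section \<open>Sorted lists of pairs\<close>

definition sort_pair :: "nat \<times> nat \<Rightarrow> int \<times> nat" where
  "sort_pair x = (- int (fst x), snd x)"

definition sorted_pair_lists :: "nat \<Rightarrow> (nat \<Rightarrow> nat) \<Rightarrow> nat \<Rightarrow> (nat \<times> nat) list set" where
  "sorted_pair_lists n m t =
     {xs. sorted (map sort_pair xs) \<and> mset xs \<in> pair_multisets {..t} {1..n} m}"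

lemma inj_sort_pair: "inj sort_pair"
  by (auto simp: inj_def sort_pair_def prod_eq_iff)

text \<open>Negating the first component makes the lexicographic order sort by decreasing exponent
  and then by increasing letter; the resulting condition on neighbours is the one that the tail sums
  satisfy.\<close>

lemma sorted_sort_pair_iff:
  "sorted (map sort_pair xs) \<longleftrightarrow> (\<forall>i. Suc i < length xs \<longrightarrow>
     fst (xs ! Suc i) < fst (xs ! i) \<or> fst (xs ! Suc i) = fst (xs ! i) \<and> snd (xs ! i) \<le> snd (xs ! Suc i))"
  unfolding sorted_iff_nth_Suc by (auto simp: sort_pair_def)

lemma mset_mem_pair_multisets_iff:
  "mset xs \<in> pair_multisets F K m \<longleftrightarrow>
    set xs \<subseteq> F \<times> K \<and> (\<forall>k\<in>K. count_list (map snd xs) k = m k)"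
proof -
  have "size (filter_mset (\<lambda>x. snd x = k) (mset xs)) = count_list (map snd xs) k" for k
    by (induction xs) auto
  then show ?thesis
    by (simp add: pair_multisets_def)
qed

lemma length_sorted_pair_lists:
  assumes "xs \<in> sorted_pair_lists n m t"
  shows "length xs = (\<Sum>k=1..n. m k)"
proof -
  have *: "set xs \<subseteq> {..t} \<times> {1..n}" "\<forall>k\<in>{1..n}. count_list (map snd xs) k = m k"
    using assms by (auto simp: sorted_pair_lists_def mset_mem_pair_multisets_iff)
  then have "(\<Sum>k=1..n. count_list (map snd xs) k) = length (map snd xs)"
    by (intro sum_count_set) auto
  with * show ?thesis
    by simp
qed

section \<open>Inverse maps between words with exponents and sorted lists\<close>

definition word_to_pairs :: "nat \<Rightarrow> colored_word \<times> (nat \<Rightarrow> nat) \<Rightarrow> nat \<times> (nat \<times> nat) list" where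
  "word_to_pairs M = (\<lambda>(w, e). (sum e {0..M}, map (\<lambda>j. (sum e {Suc j..M}, fst (w ! j))) [0..<M]))"

text \<open>The dropped colors return as residues, and the exponents as differences of the sequence
  of tail sums, completed by the total \<open>t\<close> in front and the empty sum 0 at the
  end.\<close>

definition pairs_to_word :: "nat \<Rightarrow> nat \<Rightarrow> nat \<times> (nat \<times> nat) list \<Rightarrow> colored_word \<times> (nat \<Rightarrow> nat)" where
  "pairs_to_word r M = (\<lambda>(t, xs).
     (map (\<lambda>(f, k). (k, 1 + f mod r)) xs,
      \<lambda>i\<in>{0..M}. (t # map fst xs @ [0]) ! i - (t # map fst xs @ [0]) ! Suc i))"

text \<open>Consecutive tail sums differ by an exponent, so they decrease weakly, with ties only at
  exponent 0, where the letters are known to increase weakly.\<close>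

lemma word_to_pairs_mem:
  assumes r: "r \<ge> 1" and M: "M = (\<Sum>k=1..n. m k)"
    and a: "a \<in> (SIGMA w:colored_multiset_perms n m r. PiE {0..M} (exponents n r w))"
  shows "word_to_pairs M a \<in> (SIGMA t:UNIV. sorted_pair_lists n m t)"
    and "pairs_to_word r M (word_to_pairs M a) = a"
proof -
  obtain w e where a_eq: "a = (w, e)" and w: "w \<in> colored_multiset_perms n m r"
    and e: "e \<in> PiE {0..M} (exponents n r w)"
    using a by auto
  have len: "length w = M"
    using length_colored_multiset_perms[OF w] M by simp
  have "\<forall>i\<in>{1..M}. e i \<in> exponents n r w i"
    using e by auto
  then have *: "snd (colored_letter n w i) = 1 + sum e {i..M} mod r"
      "e i = 0 \<Longrightarrow> fst (colored_letter n w i) \<le> fst (colored_letter n w (Suc i))"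
    if "i \<in> {1..M}" for i
    unfolding exponents_iff_tail_sums[OF w r len[symmetric]] using that by auto
  let ?xs = "map (\<lambda>j. (sum e {Suc j..M}, fst (w ! j))) [0..<M]"
  have tail: "sum e {i..M} = e i + sum e {Suc i..M}" if "i \<le> M" for i
    using that by (rule sum.atLeast_Suc_atMost)
  have "sorted (map sort_pair ?xs)"
    unfolding sorted_sort_pair_iff
  proof (intro allI impI)
    fix i assume "Suc i < length ?xs"
    then have i: "Suc i < M"
      by simp
    have "fst (w ! i) \<le> fst (w ! Suc i)" if "e (Suc i) = 0"
      using *(2)[of "Suc i"] that i len by simp
    then show "fst (?xs ! Suc i) < fst (?xs ! i) \<or>
        fst (?xs ! Suc i) = fst (?xs ! i) \<and> snd (?xs ! i) \<le> snd (?xs ! Suc i)"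
      using i tail[of "Suc i"] by auto
  qed
  moreover have "mset ?xs \<in> pair_multisets {..sum e {0..M}} {1..n} m"
    unfolding mset_mem_pair_multisets_iff
  proof
    have w': "set w \<subseteq> {1..n} \<times> {1..r}"
      using w by (simp add: colored_multiset_perms_def)
    show "set ?xs \<subseteq> {..sum e {0..M}} \<times> {1..n}"
    proof
      fix x assume "x \<in> set ?xs"
      then obtain j where j: "j < M" "x = (sum e {Suc j..M}, fst (w ! j))"
        by auto
      have "w ! j \<in> {1..n} \<times> {1..r}"
        using w' j len nth_mem by blast
      moreover have "sum e {Suc j..M} \<le> sum e {0..M}"
        by (rule sum_mono2) auto
      ultimately show "x \<in> {..sum e {0..M}} \<times> {1..n}"
        using j by auto
    qed
    have "map snd ?xs = map fst w"
      by (rule nth_equalityI) (simp_all add: len)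
    then show "\<forall>k\<in>{1..n}. count_list (map snd ?xs) k = m k"
      using w by (simp add: colored_multiset_perms_def)
  qed
  ultimately show "word_to_pairs M a \<in> (SIGMA t:UNIV. sorted_pair_lists n m t)"
    by (simp add: a_eq word_to_pairs_def sorted_pair_lists_def)
  \<comment> \<open>The completed list gives the tail sums at all indices from 0 to
    \<open>Suc M\<close>, so its differences return \<open>e\<close>.\<close>
  let ?h = "\<lambda>i. (sum e {0..M} # map fst ?xs @ [0]) ! i"
  have h: "?h i = sum e {i..M}" if "i \<le> Suc M" for i
  proof (cases i)
    case (Suc j)
    then show ?thesis
      using that by (cases "j = M") (simp_all add: nth_append)
  qed simp
  have "map (\<lambda>(f, k). (k, 1 + f mod r)) ?xs = w"
  proof (rule nth_equalityI)
    fix i assume "i < length (map (\<lambda>(f, k). (k, 1 + f mod r)) ?xs)"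
    then have i: "i < M"
      by simp
    then show "map (\<lambda>(f, k). (k, 1 + f mod r)) ?xs ! i = w ! i"
      using *(1)[of "Suc i"] len by (simp add: prod_eq_iff)
  qed (simp add: len)
  moreover have "(\<lambda>i\<in>{0..M}. ?h i - ?h (Suc i)) = e"
  proof
    fix i
    show "(\<lambda>i\<in>{0..M}. ?h i - ?h (Suc i)) i = e i"
    proof (cases "i \<le> M")
      case True
      then show ?thesis
        using h[of i] h[of "Suc i"] tail[of i] by (simp only: restrict_apply) simp
    next
      case False
      then show ?thesis
        using PiE_arb[OF e, of i] by simp
    qed
  qed
  ultimately show "pairs_to_word r M (word_to_pairs M a) = a"
    by (simp only: a_eq word_to_pairs_def pairs_to_word_def prod.case)
qed

text \<open>The differences telescope back to the entries of the list, so the sorting condition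
  becomes the tail-sum condition on exponents.\<close>

lemma pairs_to_word_mem:
  assumes r: "r \<ge> 1" and M: "M = (\<Sum>k=1..n. m k)"
    and b: "b \<in> (SIGMA t:UNIV. sorted_pair_lists n m t)"
  shows "pairs_to_word r M b \<in> (SIGMA w:colored_multiset_perms n m r. PiE {0..M} (exponents n r w))"
    and "word_to_pairs M (pairs_to_word r M b) = b"
proof -
  obtain t xs where b_eq: "b = (t, xs)" and xs: "xs \<in> sorted_pair_lists n m t"
    using b by auto
  have len: "length xs = M"
    using length_sorted_pair_lists[OF xs] M by simp
  have sorted: "\<And>i. Suc i < M \<Longrightarrow> fst (xs ! Suc i) < fst (xs ! i) \<or>
      fst (xs ! Suc i) = fst (xs ! i) \<and> snd (xs ! i) \<le> snd (xs ! Suc i)"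
    and set: "set xs \<subseteq> {..t} \<times> {1..n}"
    and count: "\<And>k. k \<in> {1..n} \<Longrightarrow> count_list (map snd xs) k = m k"
    using xs len unfolding sorted_pair_lists_def mset_mem_pair_multisets_iff sorted_sort_pair_iff by auto
  define h where "h = (\<lambda>i. (t # map fst xs @ [0]) ! i)"
  define w where "w = map (\<lambda>(f, k). (k, 1 + f mod r)) xs"
  define e where "e = (\<lambda>i\<in>{0..M}. h i - h (Suc i))"
  have eq: "pairs_to_word r M b = (w, e)"
    by (simp add: b_eq pairs_to_word_def w_def e_def h_def)
  have h0: "h 0 = t" and hM: "h (Suc M) = 0" and h: "\<And>i. i < M \<Longrightarrow> h (Suc i) = fst (xs ! i)"
    using len by (simp_all add: h_def nth_append)
  have in_set: "xs ! i \<in> {..t} \<times> {1..n}" if "i < M" for i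
    using set that len nth_mem by blast
  \<comment> \<open>This makes the truncated subtraction in \<open>e\<close> exact. The bound
    \<open>t\<close> on the entries covers the first step, and the final 0 the last.\<close>
  have mono: "h (Suc i) \<le> h i" if "i \<le> M" for i
  proof (cases i)
    case 0
    then show ?thesis
      using h0 hM h[of 0] in_set[of 0] by (cases "M = 0") auto
  next
    case (Suc j)
    then show ?thesis
      using that hM h[of j] h[of i] sorted[of j] by (cases "i = M") auto
  qed
  have tail: "sum e {i..M} = h i" if "i \<le> Suc M" for i
    using that
  proof (induction rule: inc_induct)
    case (step i)
    then have "sum e {i..M} = e i + sum e {Suc i..M}"
      by (intro sum.atLeast_Suc_atMost) simp
    with step mono[of i] show ?case
      by (simp add: e_def)
  qed (simp add: hM)
  have len_w: "M = length w"
    by (simp add: w_def len)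
  have w_nth: "w ! i = (snd (xs ! i), 1 + fst (xs ! i) mod r)" if "i < M" for i
    using that len by (simp add: w_def case_prod_unfold)
  have "map fst w = map snd xs"
    by (simp add: w_def case_prod_unfold)
  moreover have "set w \<subseteq> {1..n} \<times> {1..r}"
  proof
    fix x assume "x \<in> set w"
    then obtain y where y: "y \<in> set xs" "x = (snd y, 1 + fst y mod r)"
      by (auto simp: w_def)
    have "fst y mod r < r"
      using r by simp
    then show "x \<in> {1..n} \<times> {1..r}"
      using y set by auto
  qed
  ultimately have w: "w \<in> colored_multiset_perms n m r"
    using count by (simp add: colored_multiset_perms_def)
  have "\<forall>i\<in>{1..M}. e i \<in> exponents n r w i"
    unfolding exponents_iff_tail_sums[OF w r len_w]
  proof (intro ballI conjI impI)
    fix i assume i: "i \<in> {1..M}"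
    then obtain j where j: "i = Suc j" "j < M"
      by (cases i) auto
    show "snd (colored_letter n w i) = 1 + sum e {i..M} mod r"
      using i j h[of j] w_nth[of j] tail[of i] len_w by simp
    assume e0: "e i = 0"
    show "fst (colored_letter n w i) \<le> fst (colored_letter n w (Suc i))"
    proof (cases "i = M")
      \<comment> \<open>The appended letter \<open>n + 1\<close> exceeds every letter of the
        word.\<close>
      case True
      have "colored_letter n w i = w ! j" "colored_letter n w (Suc i) = (n + 1, 1)"
        using j len_w colored_letter_end[of n w] by (simp, simp only: True)
      then show ?thesis
        using j in_set[of j] w_nth[of j] by auto
    next
      case False
      then have "Suc j < M"
        using i j by simp
      moreover have "h (Suc i) = h i"
        using e0 mono[of i] i by (simp add: e_def)
      ultimately show ?thesis
        using j h[of j] h[of i] sorted[of j] w_nth[of j] w_nth[of i] len_w by simp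
    qed
  qed
  then have "e i \<in> exponents n r w i" if "i \<le> M" for i
    using that by (cases "i = 0") (auto simp: exponents_def)
  then have "e \<in> PiE {0..M} (exponents n r w)"
    by (auto simp: e_def)
  with w show "pairs_to_word r M b \<in> (SIGMA w:colored_multiset_perms n m r. PiE {0..M} (exponents n r w))"
    by (simp add: eq)
  have "map (\<lambda>j. (sum e {Suc j..M}, fst (w ! j))) [0..<M] = xs"
    by (rule nth_equalityI) (simp_all add: len tail h w_nth)
  then show "word_to_pairs M (pairs_to_word r M b) = b"
    unfolding eq using tail[of 0] h0 by (simp add: word_to_pairs_def b_eq)
qed

text \<open>The letter at position \<open>j\<close> occurs in the prefixes of length at least
  \<open>j\<close>, so exchanging the products gives it a tail sum as exponent;
  \<open>mfps_var 0\<close> occurs in all of them.\<close>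

lemma prod_prefix_monom_power:
  fixes e :: "nat \<Rightarrow> nat"
  assumes "M = length w"
  shows "(\<Prod>i=0..M. prefix_monom n w i ^ e i) =
    (mfps_var 0 :: (nat, 'a :: comm_ring_1) mfps) ^ sum e {0..M} *
    (\<Prod>j<M. mfps_var (fst (w ! j)) ^ sum e {Suc j..M})"
proof -
  let ?v = "\<lambda>j. mfps_var (fst (colored_letter n w j)) :: (nat, 'a) mfps"
  have "(\<Prod>i=0..M. \<Prod>j=1..i. ?v j ^ e i) = (\<Prod>i=0..M. \<Prod>j | j \<in> {1..M} \<and> j \<le> i. ?v j ^ e i)"
    by (intro prod.cong) auto
  also have "\<dots> = (\<Prod>j=1..M. \<Prod>i | i \<in> {0..M} \<and> j \<le> i. ?v j ^ e i)"
    by (rule prod.swap_restrict) simp_all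
  also have "\<dots> = (\<Prod>j=1..M. ?v j ^ sum e {j..M})"
  proof (rule prod.cong)
    fix j assume "j \<in> {1..M}"
    have "{i. i \<in> {0..M} \<and> j \<le> i} = {j..M}"
      by auto
    then show "(\<Prod>i | i \<in> {0..M} \<and> j \<le> i. ?v j ^ e i) = ?v j ^ sum e {j..M}"
      by (simp add: power_sum)
  qed simp
  also have "\<dots> = (\<Prod>j<M. mfps_var (fst (w ! j)) ^ sum e {Suc j..M})"
    using assms by (simp add: prod.atLeast1_atMost_eq)
  finally show ?thesis
    by (simp add: prefix_monom_def power_mult_distrib prod.distrib power_sum prod_power_distrib)
qed

text \<open>Each index contributes a geometric series shifted by its least exponent, that is, a sum
  over its progression of exponents; multiplying these series out gives a sum over exponent
  functions.\<close>

lemma mfps_has_sum_exponents: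
  fixes n r :: nat and w :: colored_word
  defines "P \<equiv> prefix_monom n w :: nat \<Rightarrow> (nat, 'a :: comm_ring_1) mfps"
  assumes r: "r \<ge> 1" and M: "M = length w"
  shows "((\<lambda>e. \<Prod>i=0..M. P i ^ e i) has_sum
    ((\<Prod>i=1..M. P i ^ color_change n r w i) *
      (\<Prod>i | i \<in> DES n w \<and> color_change n r w i = 0. P i ^ r)) /
    ((1 - mfps_var 0) * (\<Prod>i=1..M. 1 - P i ^ r))) (PiE {0..M} (exponents n r w))"
proof -
  let ?I = "{1..M}"
  have P0: "P 0 = mfps_var 0"
    by (simp add: P_def prefix_monom_def)
  have P_coeff: "mfps_coeff (P i) 0 = 0" for i
    by (simp add: P_def prefix_monom_def mfps_coeff_mult_0)
  then have Pr: "mfps_coeff (P i ^ r) 0 = 0" for i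
    using r by (intro mfps_coeff_power_0) simp_all
  define s where "s i = (if i = 0 then inverse (1 - P 0)
      else P i ^ least_exponent n r w i * inverse (1 - P i ^ r))" for i
  have "((\<lambda>e. P i ^ e) has_sum s i) (exponents n r w i)" for i
  proof (cases "i = 0")
    case True
    then show ?thesis
      using mfps_has_sum_geometric[OF P_coeff] by (simp add: s_def exponents_def)
  next
    case False
    let ?f = "\<lambda>j. least_exponent n r w i + r * j"
    have "((\<lambda>j. P i ^ least_exponent n r w i * (P i ^ r) ^ j) has_sum s i) UNIV"
      using mfps_has_sum_cmult[OF mfps_has_sum_geometric[OF Pr]] False by (simp add: s_def)
    then have "(((\<lambda>e. P i ^ e) \<circ> ?f) has_sum s i) UNIV"
      by (simp add: comp_def power_add power_mult)
    moreover have "inj ?f"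
      using r by (simp add: inj_def)
    ultimately have "((\<lambda>e. P i ^ e) has_sum s i) (range ?f)"
      by (simp add: has_sum_reindex)
    with False show ?thesis
      by (simp add: exponents_def)
  qed
  then have sum: "((\<lambda>e. \<Prod>i=0..M. P i ^ e i) has_sum (\<Prod>i=0..M. s i)) (PiE {0..M} (exponents n r w))"
    by (intro mfps_has_sum_prod_PiE) simp_all
  have "(\<Prod>i=0..M. s i) = s 0 * (\<Prod>i\<in>?I. s i)"
    by (subst prod.atLeast_Suc_atMost) simp_all
  also have "(\<Prod>i\<in>?I. s i) = (\<Prod>i\<in>?I. P i ^ least_exponent n r w i) * (\<Prod>i\<in>?I. inverse (1 - P i ^ r))"
    unfolding prod.distrib[symmetric] by (rule prod.cong) (auto simp: s_def)
  also have "(\<Prod>i\<in>?I. P i ^ least_exponent n r w i) =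
      (\<Prod>i\<in>?I. P i ^ color_change n r w i) *
      (\<Prod>i | i \<in> DES n w \<and> color_change n r w i = 0. P i ^ r)"
  proof -
    \<comment> \<open>Descents lie in \<open>{1..M}\<close>, so their factor spreads over all
      positions with exponent \<open>r\<close> or 0 and merges with the color changes.\<close>
    have "{i. i \<in> DES n w \<and> color_change n r w i = 0} = {i \<in> ?I. i \<in> DES n w \<and> color_change n r w i = 0}"
      using M by (auto simp: DES_def)
    then have "(\<Prod>i | i \<in> DES n w \<and> color_change n r w i = 0. P i ^ r) =
        (\<Prod>i\<in>?I. if i \<in> DES n w \<and> color_change n r w i = 0 then P i ^ r else 1)"
      by (simp only: prod.inter_filter[OF finite_atLeastAtMost])
    also have "\<dots> = (\<Prod>i\<in>?I. P i ^ (if i \<in> DES n w \<and> color_change n r w i = 0 then r else 0))"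
      by (rule prod.cong) auto
    finally show ?thesis
      by (simp only: least_exponent_def power_add prod.distrib)
  qed
  finally have prod_s: "(\<Prod>i=0..M. s i) = inverse (1 - mfps_var 0) *
      (((\<Prod>i\<in>?I. P i ^ color_change n r w i) *
        (\<Prod>i | i \<in> DES n w \<and> color_change n r w i = 0. P i ^ r)) *
       (\<Prod>i\<in>?I. inverse (1 - P i ^ r)))"
    by (simp add: s_def P0)
  \<comment> \<open>Uniqueness of inverses identifies the inverse of the whole denominator with the
    product of the inverses.\<close>
  have "((1 - P 0) * inverse (1 - P 0)) * (\<Prod>i\<in>?I. (1 - P i ^ r) * inverse (1 - P i ^ r)) = 1"
    by (simp only: mfps_one_minus_inverse[OF P_coeff] mfps_one_minus_inverse[OF Pr] prod.neutral_const mult_1_left)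
  then have "((1 - mfps_var 0) * (\<Prod>i\<in>?I. 1 - P i ^ r)) *
      (inverse (1 - mfps_var 0) * (\<Prod>i\<in>?I. inverse (1 - P i ^ r))) = 1"
    by (simp only: P0 prod.distrib mult_ac)
  from mfps_inverse_unique[OF this] show ?thesis
    using sum unfolding prod_s divide_mfps_def by (simp only: mult_ac)
qed

section \<open>Assembly of the identity\<close>

lemma bij_betw_sorted_pair_lists:
  "bij_betw mset (sorted_pair_lists n m t) (pair_multisets {..t} {1..n} m)"
  unfolding sorted_pair_lists_def by (rule bij_betw_mset_sorted_key[OF inj_sort_pair])

theorem theorem10:
  fixes n r M :: nat and m :: "nat \<Rightarrow> nat"
  assumes "n \<ge> 1" and "r \<ge> 1"
    and "\<And>k. k \<in> {1..n} \<Longrightarrow> m k > 0"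
    and "M = (\<Sum>k=1..n. m k)"
  shows "(\<lambda>t. mfps_var 0 ^ t * (\<Prod>k=1..n. gauss_binomial (t + m k) (m k) (mfps_var k))) sums
    (\<Sum>w\<in>colored_multiset_perms n m r.
       ((\<Prod>i=1..M. prefix_monom n w i ^ color_change n r w i) *
        (\<Prod>i | i \<in> DES n w \<and> color_change n r w i = 0. prefix_monom n w i ^ r)) /
       ((1 - mfps_var 0) * (\<Prod>i=1..M. 1 - prefix_monom n w i ^ r))
       :: (nat, 'a :: comm_ring_1) mfps)"
    (is "_ sums (\<Sum>w\<in>?W. ?s w)")
proof -
  let ?v = "mfps_var :: nat \<Rightarrow> (nat, 'a) mfps"
  \<comment> \<open>\<open>g\<close> and \<open>h\<close> give the same monomials, indexed by words
    with exponents and by sorted lists graded by \<open>t\<close>.\<close>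
  define g where "g = (\<lambda>(w, e). \<Prod>i=0..M. prefix_monom n w i ^ e i :: (nat, 'a) mfps)"
  define h where "h = (\<lambda>(t, xs). ?v 0 ^ t * (\<Prod>x\<in>#mset xs. ?v (snd x) ^ fst x))"
  note len = length_colored_multiset_perms[of _ n m r, folded \<open>M = _\<close>]
  have "(g has_sum (\<Sum>w\<in>?W. ?s w)) (SIGMA w:?W. PiE {0..M} (exponents n r w))"
  proof (rule mfps_has_sum_Sigma_finite[OF finite_colored_multiset_perms])
    fix w assume "w \<in> ?W"
    from len[OF this] show "((\<lambda>e. g (w, e)) has_sum ?s w) (PiE {0..M} (exponents n r w))"
      unfolding g_def prod.case by (intro mfps_has_sum_exponents[OF \<open>r \<ge> 1\<close>]) simp
  qed
  also have "?this \<longleftrightarrow> (h has_sum (\<Sum>w\<in>?W. ?s w)) (SIGMA t:UNIV. sorted_pair_lists n m t)"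
  proof (rule has_sum_reindex_bij_witness[of _ "pairs_to_word r M" "word_to_pairs M"])
    fix a assume a_mem: "a \<in> (SIGMA w:?W. PiE {0..M} (exponents n r w))"
    then show "word_to_pairs M a \<in> (SIGMA t:UNIV. sorted_pair_lists n m t)"
      "pairs_to_word r M (word_to_pairs M a) = a"
      by (rule word_to_pairs_mem[OF assms(2,4)])+
    obtain w e where a: "a = (w, e)" "w \<in> ?W"
      using a_mem by auto
    have "(\<Prod>x\<in>#mset (map (\<lambda>j. (sum e {Suc j..M}, fst (w ! j))) [0..<M]). ?v (snd x) ^ fst x) =
        (\<Prod>j<M. ?v (fst (w ! j)) ^ sum e {Suc j..M})"
      by (simp add: prod_unfold_prod_mset multiset.map_comp comp_def lessThan_atLeast0)
    then show "h (word_to_pairs M a) = g a"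
      using len[OF a(2)]
      by (simp only: a(1) h_def g_def word_to_pairs_def prod.case prod_prefix_monom_power)
  qed (rule pairs_to_word_mem[OF assms(2,4)] refl; assumption?)+
  finally have "(\<lambda>t. \<Sum>xs\<in>sorted_pair_lists n m t. h (t, xs)) sums (\<Sum>w\<in>?W. ?s w)"
  proof (rule mfps_has_sum_imp_sums)
    show "finite (sorted_pair_lists n m t)" for t
      using bij_betw_finite[OF bij_betw_sorted_pair_lists] finite_pair_multisets by simp
  qed
  \<comment> \<open>On the slice of a fixed \<open>t\<close>, the order of the list does not affect
    the monomial, so the sum runs over multisets of pairs.\<close>
  moreover have "(\<Sum>xs\<in>sorted_pair_lists n m t. h (t, xs)) =
      ?v 0 ^ t * (\<Prod>k=1..n. gauss_binomial (t + m k) (m k) (?v k))" for t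
  proof -
    have "(\<Sum>xs\<in>sorted_pair_lists n m t. h (t, xs)) =
        (\<Sum>B\<in>pair_multisets {..t} {1..n} m. ?v 0 ^ t * (\<Prod>x\<in>#B. ?v (snd x) ^ fst x))"
      unfolding h_def prod.case by (rule sum.reindex_bij_betw[OF bij_betw_sorted_pair_lists])
    then show ?thesis
      by (simp add: prod_gauss_binomial_eq_sum sum_distrib_left)
  qed
  ultimately show ?thesis
    by simp
qed

end
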